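(* Let $p,q>0$ be real numbers with $\frac1p+\frac1q=1$, let $X_1,X_2$ be separable reflexive Banach spaces, let $(\psi_k)\subseteq X_1^*$ be a $p$-Bessel sequence for $X_1$ with bound $B_1$, and let $(\phi_k)\subseteq X_2$ be a $q$-Bessel sequence for $X_2^*$ with bound $B_2$. Let $r>0$ and $m=(m_k)\in\ell^r$. Then the operator $\mathbf{M}=\mathbf{M}_{m,(\phi_k),(\psi_k)}:X_1\to X_2$, $\mathbf{M}(f)=\sum_k m_k\,\psi_k(f)\,\phi_k$, is an $(r,p,q)$-nuclear operator, and $$N_{(r,p,q)}(\mathbf{M})\le B_1B_2\|m\|_r.$$
   Context: All sequences are indexed by the same countable set. A countable family $(g_i)\subseteq X^*$ is a $p$-Bessel sequence for a Banach space $X$ ($1<p<\infty$) with bound $B>0$ if $\left(\sum_i|g_i(f)|^p\right)^{1/p}\le B\|f\|_X$ for all $f\in X$. A family $(\phi_k)\subseteq X_2$ is a $q$-Bessel sequence for $X_2^*$ with bound $B_2$ (identifying $X_2=X_2^{**}$) if $\left(\sum_k|h(\phi_k)|^q\right)^{1/q}\le B_2\|h\|$ for all $h\in X_2^*$. Weakly summable families: for $0<s\le\infty$, a family $(x_i)$ in a Banach space $X$ is weakly $s$-summable, written $(x_i)\in W_s(X)$, if $(x^*(x_i))_i\in\ell^s$ for every $x^*\in X^*$; put $w_s(x_i)=\sup\{\|(x^*(x_i))_i\|_s:\ x^*\in X^*,\ \|x^*\|\le1\}$. Nuclear operators: let $0<r\le\infty$, $1\le p_1,q_1\le\infty$ with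 $1+\frac1r\ge\frac1{p_1}+\frac1{q_1}$, and let $p',q'$ be given by $\frac1{p_1}+\frac1{p'}=\frac1{q_1}+\frac1{q'}=1$. A bounded operator $S:X\to Y$ between Banach spaces is $(r,p_1,q_1)$-nuclear if $S=\sum_{i=1}^\infty\sigma_i\,x_i^*\otimes y_i$, meaning $Sx=\sum_{i=1}^\infty\sigma_i\,x_i^*(x)\,y_i$ for $x\in X$, with $(\sigma_i)\in\ell^r$ (with $(\sigma_i)\in\mathbf{c}_0$ if $r=\infty$), $(x_i^* )\in W_{q'}(X^* )$ and $(y_i)\in W_{p'}(Y)$. Then $N_{(r,p_1,q_1)}(S)=\inf\{\|(\sigma_i)\|_r\,w_{q'}(x_i^* )\,w_{p'}(y_i)\}$, the infimum being over all such representations. Here $\|(\sigma_i)\|_r=\left(\sum_i|\sigma_i|^r\right)^{1/r}$ also for $0<r<1$. *)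

theory Defs
  imports "HOL-Analysis.Analysis"
begin

(* The scalar field K is the real or the complex field; both cases are treated at once.
   The assumption says K = R or K = R + iR, with an absolute value extending that of R
   (which determines it in both cases). *)
class real_or_complex = real_normed_field +
  assumes real_or_complex:
    "(\<forall>z. \<exists>a. z = a *\<^sub>R 1) \<or> (\<exists>i. i * i = - 1 \<and> (\<forall>z. \<exists>a b. z = a *\<^sub>R 1 + b *\<^sub>R i))"

instance real :: real_or_complex
  by standard simp

instance complex :: real_or_complex
proof
  have "z = Re z *\<^sub>R 1 + Im z *\<^sub>R \<i>" for z
    by (simp add: complex_eq_iff)
  then show "(\<forall>z::complex. \<exists>a. z = a *\<^sub>R 1)
      \<or> (\<exists>i::complex. i * i = - 1 \<and> (\<forall>z. \<exists>a b. z = a *\<^sub>R 1 + b *\<^sub>R i))"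
    using i_squared by blast
qed

(* A Banach space over K is a (real) Banach space type together with a multiplication by
   scalars of K that extends the real one. *)
locale banach_space_over = vector_space smul
  for smul :: "'k::real_or_complex \<Rightarrow> 'a::banach \<Rightarrow> 'a" +
  assumes norm_scale: "norm (smul c x) = norm c * norm x"
    and scale_of_real: "smul (of_real t) x = t *\<^sub>R x"

(* Bounded K-linear functionals on a K-subspace V. They are plain functions, of which only the
   values on V matter; this allows V to be the dual of a Banach space, see below. *)
definition functionals ::
  "'v::real_normed_vector set \<Rightarrow> ('k::real_or_complex \<Rightarrow> 'v \<Rightarrow> 'v) \<Rightarrow> ('v \<Rightarrow> 'k) set" where
  "functionals V smul = {h.
     (\<forall>x\<in>V. \<forall>y\<in>V. h (x + y) = h x + h y) \<and>
     (\<forall>c. \<forall>x\<in>V. h (smul c x) = c * h x) \<and>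
     (\<exists>C. \<forall>x\<in>V. norm (h x) \<le> C * norm x)}"

definition functional_norm ::
  "'v::real_normed_vector set \<Rightarrow> ('v \<Rightarrow> 'k::real_or_complex) \<Rightarrow> real" where
  "functional_norm V h = (SUP x\<in>{x\<in>V. norm x \<le> 1}. norm (h x))"

(* The dual Banach space: the K-linear maps among all real-linear bounded maps into K, with the
   norm of the ambient type. For K = R it is the whole type. *)
definition dual ::
  "('k::real_or_complex \<Rightarrow> 'a::real_normed_vector \<Rightarrow> 'a) \<Rightarrow> ('a \<Rightarrow>\<^sub>L 'k) set" where
  "dual smul = {f. \<forall>c x. blinfun_apply f (smul c x) = c * blinfun_apply f x}"

definition dual_scale ::
  "'k::real_or_complex \<Rightarrow> ('a::real_normed_vector \<Rightarrow>\<^sub>L 'k) \<Rightarrow> ('a \<Rightarrow>\<^sub>L 'k)" where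
  "dual_scale c f = blinfun_mult_right c o\<^sub>L f"

definition reflexive :: "('k::real_or_complex \<Rightarrow> 'a::real_normed_vector \<Rightarrow> 'a) \<Rightarrow> bool" where
  "reflexive smul \<longleftrightarrow>
     (\<forall>\<Phi>\<in>functionals (dual smul) dual_scale. \<exists>x. \<forall>f\<in>dual smul. \<Phi> f = blinfun_apply f x)"

(* Exponents range over (0,\<infinity>], as elements of ennreal. *)
definition in_lp :: "ennreal \<Rightarrow> 'i set \<Rightarrow> ('i \<Rightarrow> 'k::real_normed_vector) \<Rightarrow> bool" where
  "in_lp s I a \<longleftrightarrow>
     (if s = \<infinity> then bounded (a ` I) else (\<lambda>i. norm (a i) powr enn2real s) summable_on I)"

definition lp_norm :: "ennreal \<Rightarrow> 'i set \<Rightarrow> ('i \<Rightarrow> 'k::real_normed_vector) \<Rightarrow> real" where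
  "lp_norm s I a =
     (if s = \<infinity> then (SUP i\<in>I. norm (a i))
      else (\<Sum>\<^sub>\<infinity>i\<in>I. norm (a i) powr enn2real s) powr (1 / enn2real s))"

(* With V = dual smul, the family of evaluations g k h = h (\<phi> k) expresses that (\<phi> k) is a Bessel
   sequence for the dual space. *)
definition bessel ::
  "real \<Rightarrow> 'i set \<Rightarrow> 'v::real_normed_vector set \<Rightarrow> ('k::real_or_complex \<Rightarrow> 'v \<Rightarrow> 'v) \<Rightarrow>
   ('i \<Rightarrow> 'v \<Rightarrow> 'k) \<Rightarrow> real \<Rightarrow> bool" where
  "bessel p I V smul g B \<longleftrightarrow>
     1 < p \<and> 0 < B \<and> (\<forall>i\<in>I. g i \<in> functionals V smul) \<and>
     (\<forall>f\<in>V. in_lp (ennreal p) I (\<lambda>i. g i f) \<and> lp_norm (ennreal p) I (\<lambda>i. g i f) \<le> B * norm f)"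

definition weakly_summable ::
  "ennreal \<Rightarrow> 'v::real_normed_vector set \<Rightarrow> ('k::real_or_complex \<Rightarrow> 'v \<Rightarrow> 'v) \<Rightarrow>
   (nat \<Rightarrow> 'v) \<Rightarrow> bool" where
  "weakly_summable s V smul x \<longleftrightarrow>
     (\<forall>i. x i \<in> V) \<and> (\<forall>h\<in>functionals V smul. in_lp s UNIV (\<lambda>i. h (x i)))"

definition weak_norm ::
  "ennreal \<Rightarrow> 'v::real_normed_vector set \<Rightarrow> ('k::real_or_complex \<Rightarrow> 'v \<Rightarrow> 'v) \<Rightarrow>
   (nat \<Rightarrow> 'v) \<Rightarrow> ennreal" where
  "weak_norm s V smul x =
     (SUP h\<in>{h\<in>functionals V smul. functional_norm V h \<le> 1}.
        ennreal (lp_norm s UNIV (\<lambda>i. h (x i))))"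

(* The solution p' of 1/p + 1/p' = 1; in ennreal this includes p = 1 and p = \<infinity>. *)
definition conjugate_exponent :: "ennreal \<Rightarrow> ennreal" where
  "conjugate_exponent p = inverse (1 - inverse p)"

definition nuclear_representation ::
  "ennreal \<Rightarrow> ennreal \<Rightarrow> ennreal \<Rightarrow>
   ('k::real_or_complex \<Rightarrow> 'a::banach \<Rightarrow> 'a) \<Rightarrow> ('k \<Rightarrow> 'b::banach \<Rightarrow> 'b) \<Rightarrow> ('a \<Rightarrow> 'b) \<Rightarrow>
   (nat \<Rightarrow> 'k) \<Rightarrow> (nat \<Rightarrow> 'a \<Rightarrow>\<^sub>L 'k) \<Rightarrow> (nat \<Rightarrow> 'b) \<Rightarrow> bool" where
  "nuclear_representation r p q scaleX scaleY S \<sigma> x' y \<longleftrightarrow>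
     (if r = \<infinity> then \<sigma> \<longlonglongrightarrow> 0 else in_lp r UNIV \<sigma>) \<and>
     weakly_summable (conjugate_exponent q) (dual scaleX) dual_scale x' \<and>
     weakly_summable (conjugate_exponent p) UNIV scaleY y \<and>
     (\<forall>x. (\<lambda>i. scaleY (\<sigma> i * blinfun_apply (x' i) x) (y i)) sums S x)"

definition nuclear ::
  "ennreal \<Rightarrow> ennreal \<Rightarrow> ennreal \<Rightarrow>
   ('k::real_or_complex \<Rightarrow> 'a::banach \<Rightarrow> 'a) \<Rightarrow> ('k \<Rightarrow> 'b::banach \<Rightarrow> 'b) \<Rightarrow> ('a \<Rightarrow> 'b) \<Rightarrow>
   bool" where
  "nuclear r p q scaleX scaleY S \<longleftrightarrow>
     0 < r \<and> 1 \<le> p \<and> 1 \<le> q \<and> inverse p + inverse q \<le> 1 + inverse r \<and>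
     bounded_linear S \<and> (\<forall>c x. S (scaleX c x) = scaleY c (S x)) \<and>
     (\<exists>\<sigma> x' y. nuclear_representation r p q scaleX scaleY S \<sigma> x' y)"

definition nuclear_norm ::
  "ennreal \<Rightarrow> ennreal \<Rightarrow> ennreal \<Rightarrow>
   ('k::real_or_complex \<Rightarrow> 'a::banach \<Rightarrow> 'a) \<Rightarrow> ('k \<Rightarrow> 'b::banach \<Rightarrow> 'b) \<Rightarrow> ('a \<Rightarrow> 'b) \<Rightarrow>
   ennreal" where
  "nuclear_norm r p q scaleX scaleY S =
     Inf {ennreal (lp_norm r UNIV \<sigma>)
            * weak_norm (conjugate_exponent q) (dual scaleX) dual_scale x'
            * weak_norm (conjugate_exponent p) UNIV scaleY y |
          \<sigma> x' y. nuclear_representation r p q scaleX scaleY S \<sigma> x' y}"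

definition multiplier ::
  "'i set \<Rightarrow> ('k::real_or_complex \<Rightarrow> 'b::banach \<Rightarrow> 'b) \<Rightarrow>
   ('i \<Rightarrow> 'k) \<Rightarrow> ('i \<Rightarrow> 'b) \<Rightarrow> ('i \<Rightarrow> 'a::banach \<Rightarrow>\<^sub>L 'k) \<Rightarrow> 'a \<Rightarrow> 'b" where
  "multiplier I scaleY m \<phi> \<psi> f = (\<Sum>\<^sub>\<infinity>k\<in>I. scaleY (m k * blinfun_apply (\<psi> k) f) (\<phi> k))"

end

theory Submission
  imports Defs
begin

text \<open>The series that defines the multiplier is itself a nuclear representation: with
$\sigma_k = m_k$, $x_k^* = \psi_k$ and $y_k = \phi_k$ the infimum in the nuclear norm is at most
$\|m\|_r\, w_p(\psi_k)\, w_q(\phi_k)$. So it is enough to bound the two weak norms by the Bessel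
bounds and to prove that the series converges.

For $(\phi_k)$ the weak norm is at most the Bessel bound by definition, once functionals are turned into
elements of the dual. For $(\psi_k)$ the weak norm runs over functionals $h$ on the dual of $X_1$,
and the Bessel condition only speaks of evaluations at points of $X_1$. The two are related by
duality of $\ell^p$ and $\ell^q$ on finite index sets: the combination $f = \sum_k c_k \psi_k$ has
norm at most $B_1 \|c\|_q$ by the inequality of Hoelder, hence
$|\sum_k c_k h(\psi_k)| = |h(f)| \le \|h\| B_1 \|c\|_q$ for all $c$, and this gives
$\|(h(\psi_k))_k\|_p \le \|h\| B_1$ (lemma \<open>functional_of_bessel_bounded\<close>).

For convergence, the coefficients $a_k = m_k \psi_k(f)$ form an $\ell^p$ family because $m$ is
bounded, and $\|\sum_{k \in F} a_k \phi_k\| \le B_2 \|(a_k)_{k \in F}\|_p$ for finite $F$ (lemma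
\<open>synthesis_bound\<close>), which makes the finite partial sums a Cauchy net and also bounds the
operator. This estimate reads the norm of a vector off the functionals on the space, so it
rests on the Hahn-Banach theorem over the scalar field $K$.
The real theorem is obtained from a minimal sublinear functional, which is automatically linear.
To pass to $K = \mathbb{R} + i\mathbb{R}$ one needs $|a + bi| = \sqrt{a^2 + b^2}$, which follows
from multiplicativity of the absolute value by taking powers.

A representation is indexed by the natural numbers, the families by an arbitrary countable set; the
families are transported along an injection and extended by zero.\<close>

section \<open>Finite sums: the duality of $\ell^p$ and $\ell^q$\<close>

lemma Hoelder_sum:
  fixes a b :: "'i \<Rightarrow> real" and p q :: real
  assumes pq: "1 < p" "1 < q" "1 / p + 1 / q = 1"
    and a: "\<And>i. i \<in> F \<Longrightarrow> 0 \<le> a i" and b: "\<And>i. i \<in> F \<Longrightarrow> 0 \<le> b i"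
  shows "(\<Sum>i\<in>F. a i * b i)
    \<le> (\<Sum>i\<in>F. a i powr p) powr (1 / p) * (\<Sum>i\<in>F. b i powr q) powr (1 / q)"
proof (cases "finite F \<and> (\<Sum>i\<in>F. a i powr p) \<noteq> 0 \<and> (\<Sum>i\<in>F. b i powr q) \<noteq> 0")
  case False
  have "(\<Sum>i\<in>F. a i * b i) = 0"
  proof (cases "finite F")
    case True
    then have "(\<forall>i\<in>F. a i powr p = 0) \<or> (\<forall>i\<in>F. b i powr q = 0)"
      using False by (simp add: sum_nonneg_eq_0_iff)
    then show ?thesis
      by (intro sum.neutral) auto
  qed simp
  then show ?thesis
    by simp
next
  case True
  define A B where "A = (\<Sum>i\<in>F. a i powr p) powr (1 / p)" and "B = (\<Sum>i\<in>F. b i powr q) powr (1 / q)"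
  have Ap: "A powr p = (\<Sum>i\<in>F. a i powr p)" and Bq: "B powr q = (\<Sum>i\<in>F. b i powr q)"
    using pq unfolding A_def B_def by (auto simp: powr_powr sum_nonneg)
  have pos: "A > 0" "B > 0"
    using True unfolding A_def B_def by (auto simp: sum_nonneg less_le)
  have "(\<Sum>i\<in>F. a i / A * (b i / B))
      \<le> (\<Sum>i\<in>F. (a i / A) powr p / p + (b i / B) powr q / q)"
    using pos a b by (intro sum_mono Youngs_inequality pq) auto
  also have "\<dots> = (\<Sum>i\<in>F. a i powr p / A powr p / p + b i powr q / B powr q / q)"
    using pos a b by (intro sum.cong refl) (simp add: powr_divide)
  also have "\<dots> = 1 / p + 1 / q"
    using True by (simp add: sum.distrib Ap Bq flip: sum_divide_distrib)
  finally have "(\<Sum>i\<in>F. a i * b i) / (A * B) \<le> 1"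
    by (simp add: pq sum_divide_distrib)
  then show ?thesis
    using pos by (simp add: A_def [symmetric] B_def [symmetric])
qed

text \<open>The inequality of Hoelder is an equality for the family $c$ with $c_i z_i = |z_i|^p$, for which
$|c_i|^q = |z_i|^p$ as well. Testing the hypothesis with this $c$ leaves
$T \le C\, T^{1/q}$ for $T = \sum_i |z_i|^p$.\<close>

lemma powr_sum_le_if_pairing_le:
  fixes z :: "'i \<Rightarrow> 'k::real_normed_field" and p q C :: real
  assumes pq: "1 < p" "1 < q" "1 / p + 1 / q = 1" and C: "0 \<le> C"
    and pairing: "\<And>c. norm (\<Sum>i\<in>F. c i * z i) \<le> C * (\<Sum>i\<in>F. norm (c i) powr q) powr (1 / q)"
  shows "(\<Sum>i\<in>F. norm (z i) powr p) powr (1 / p) \<le> C"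
proof -
  define T where "T = (\<Sum>i\<in>F. norm (z i) powr p)"
  define c where "c i = (if z i = 0 then 0 else of_real (norm (z i) powr p) / z i)" for i
  have T0: "0 \<le> T"
    unfolding T_def by (simp add: sum_nonneg)
  have q: "(p - 1) * q = p"
    using pq by (simp add: field_simps)
  have "c i * z i = of_real (norm (z i) powr p)" for i
    by (simp add: c_def)
  then have 1: "norm (\<Sum>i\<in>F. c i * z i) = T"
    using T0 by (simp add: T_def flip: of_real_sum)
  have "norm (c i) = norm (z i) powr (p - 1)" for i
    by (simp add: c_def norm_divide powr_diff)
  then have 2: "(\<Sum>i\<in>F. norm (c i) powr q) = T"
    by (simp add: T_def powr_powr q)
  have le: "T \<le> C * T powr (1 / q)"
    using pairing [of c] unfolding 1 2 .
  have p: "1 / p = 1 - 1 / q"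
    using pq by simp
  show ?thesis
  proof (cases "T = 0")
    case False
    then have "T powr (1 / p) = T / T powr (1 / q)"
      using T0 unfolding p by (simp add: powr_diff)
    then show ?thesis
      using le T0 False by (simp add: T_def [symmetric] divide_le_eq)
  qed (simp add: C T_def [symmetric])
qed

section \<open>Families in $\ell^s$ and a Cauchy criterion for unordered sums\<close>

lemma in_lp_ennreal:
  "0 < s \<Longrightarrow> in_lp (ennreal s) I a \<longleftrightarrow> (\<lambda>i. norm (a i) powr s) summable_on I"
  by (simp add: in_lp_def)

lemma lp_norm_ennreal:
  "0 < s \<Longrightarrow> lp_norm (ennreal s) I a = (\<Sum>\<^sub>\<infinity>i\<in>I. norm (a i) powr s) powr (1 / s)"
  by (simp add: lp_norm_def)

lemma lp_norm_nonneg: "0 < s \<Longrightarrow> 0 \<le> lp_norm (ennreal s) I a"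
  by (simp add: lp_norm_ennreal)

lemma finite_lp_sum_le_lp_norm:
  assumes "0 < s" "in_lp (ennreal s) I a" "finite F" "F \<subseteq> I"
  shows "(\<Sum>i\<in>F. norm (a i) powr s) powr (1 / s) \<le> lp_norm (ennreal s) I a"
  using assms unfolding lp_norm_ennreal [OF assms(1)] in_lp_ennreal [OF assms(1)]
  by (intro powr_mono2 finite_sum_le_infsum) (auto intro: sum_nonneg)

lemma lp_if_finite_sums_bounded:
  assumes s: "0 < s" and C: "0 \<le> C"
    and bound: "\<And>F. finite F \<Longrightarrow> F \<subseteq> I \<Longrightarrow> (\<Sum>i\<in>F. norm (a i) powr s) powr (1 / s) \<le> C"
  shows "in_lp (ennreal s) I a" and "lp_norm (ennreal s) I a \<le> C"
proof -
  have le: "(\<Sum>i\<in>F. norm (a i) powr s) \<le> C powr s" if "finite F" "F \<subseteq> I" for F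
  proof -
    have "((\<Sum>i\<in>F. norm (a i) powr s) powr (1 / s)) powr s \<le> C powr s"
      using bound [OF that] s by (intro powr_mono2) auto
    then show ?thesis
      using s by (simp add: powr_powr sum_nonneg)
  qed
  have summable: "(\<lambda>i. norm (a i) powr s) summable_on I"
    by (rule nonneg_bdd_above_summable_on) (auto intro!: bdd_aboveI2 le)
  then show "in_lp (ennreal s) I a"
    by (simp add: in_lp_ennreal s)
  have "(\<Sum>\<^sub>\<infinity>i\<in>I. norm (a i) powr s) \<le> C powr s"
    by (rule infsum_le_finite_sums [OF summable]) (auto intro: le)
  then have "(\<Sum>\<^sub>\<infinity>i\<in>I. norm (a i) powr s) powr (1 / s) \<le> (C powr s) powr (1 / s)"
    using s by (intro powr_mono2) (auto intro: infsum_nonneg)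
  then show "lp_norm (ennreal s) I a \<le> C"
    using s C by (simp add: lp_norm_ennreal powr_powr)
qed

lemma in_lp_bounded:
  assumes "0 < s" "in_lp (ennreal s) I a"
  obtains M where "0 \<le> M" "\<And>i. i \<in> I \<Longrightarrow> norm (a i) \<le> M"
proof
  show "0 \<le> lp_norm (ennreal s) I a"
    by (simp add: lp_norm_nonneg assms)
  show "norm (a i) \<le> lp_norm (ennreal s) I a" if "i \<in> I" for i
    using finite_lp_sum_le_lp_norm [of s I a "{i}"] assms that by (simp add: powr_powr)
qed

lemma summable_on_if_small_tails:
  fixes f :: "'i \<Rightarrow> 'b::banach"
  assumes "\<And>e. 0 < e \<Longrightarrow> \<exists>F0. finite F0 \<and> F0 \<subseteq> I \<and>
      (\<forall>G. finite G \<longrightarrow> G \<subseteq> I - F0 \<longrightarrow> norm (sum f G) < e)"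
  shows "f summable_on I"
proof -
  have "\<exists>P. eventually P (finite_subsets_at_top I) \<and>
      (\<forall>F F'. P F \<and> P F' \<longrightarrow> dist (sum f F) (sum f F') < e)" if e: "0 < e" for e
  proof -
    obtain F0 where F0: "finite F0" "F0 \<subseteq> I"
        and small: "\<And>G. finite G \<Longrightarrow> G \<subseteq> I - F0 \<Longrightarrow> norm (sum f G) < e / 2"
      using assms [of "e / 2"] e by auto
    have near: "dist (sum f F) (sum f F0) < e / 2" if "finite F" "F0 \<subseteq> F" "F \<subseteq> I" for F
      using small [of "F - F0"] that by (auto simp: dist_norm sum_diff)
    show ?thesis
    proof (intro exI conjI allI impI)
      show "eventually (\<lambda>F. finite F \<and> F0 \<subseteq> F \<and> F \<subseteq> I) (finite_subsets_at_top I)"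
        using F0 unfolding eventually_finite_subsets_at_top by blast
      show "dist (sum f F) (sum f F') < e"
        if "(finite F \<and> F0 \<subseteq> F \<and> F \<subseteq> I) \<and> (finite F' \<and> F0 \<subseteq> F' \<and> F' \<subseteq> I)" for F F'
        using near [of F] near [of F'] that dist_triangle_half_l by blast
    qed
  qed
  then have "cauchy_filter (filtermap (sum f) (finite_subsets_at_top I))"
    by (simp add: cauchy_filter_metric_filtermap)
  then obtain L where "(sum f \<longlongrightarrow> L) (finite_subsets_at_top I)"
    using complete_uniform [where S = "UNIV :: 'b set"] complete_UNIV_cuspace
    by (force simp: filterlim_def)
  then show ?thesis
    unfolding summable_on_def has_sum_def by blast
qed

section \<open>The Hahn-Banach theorem for sublinear functionals\<close>

definition sublinear :: "('a::real_vector \<Rightarrow> real) \<Rightarrow> bool" where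
  "sublinear p \<longleftrightarrow> (\<forall>x y. p (x + y) \<le> p x + p y) \<and> (\<forall>t x. 0 \<le> t \<longrightarrow> p (t *\<^sub>R x) = t * p x)"

text \<open>An inequality for positive factors is enough, since the opposite one is the same inequality for the
inverse factor.\<close>

lemma sublinearI:
  assumes add: "\<And>x y. p (x + y) \<le> p x + p y" and zero: "p 0 = 0"
    and scale: "\<And>t x. 0 < t \<Longrightarrow> t * p x \<le> p (t *\<^sub>R x)"
  shows "sublinear p"
proof -
  have "p (t *\<^sub>R x) = t * p x" if "0 \<le> t" for t x
  proof (cases "t = 0")
    case False
    with that have t: "0 < t"
      by simp
    have "inverse t * p (t *\<^sub>R x) \<le> p (inverse t *\<^sub>R t *\<^sub>R x)"
      using t by (intro scale) simp
    then have "p (t *\<^sub>R x) \<le> t * p x"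
      using t by (simp add: field_simps)
    then show ?thesis
      using scale [OF t, of x] by simp
  qed (simp add: zero)
  then show ?thesis
    using add by (simp add: sublinear_def)
qed

context
  fixes p :: "'a::real_vector \<Rightarrow> real"
  assumes p: "sublinear p"
begin

lemma sublinear_add: "p (x + y) \<le> p x + p y"
  using p by (simp add: sublinear_def)

lemma sublinear_scaleR: "0 \<le> t \<Longrightarrow> p (t *\<^sub>R x) = t * p x"
  using p by (simp add: sublinear_def)

lemma sublinear_zero: "p 0 = 0"
  using sublinear_scaleR [of 0 0] by simp

lemma sublinear_lower: "- p (- x) \<le> p x"
  using sublinear_add [of x "- x"] by (simp add: sublinear_zero)

end

text \<open>For sublinear \<open>p\<close> this is the largest sublinear $q \le p$ with $q(-y) \le -p(y)$: such a $q$
satisfies $q(x) \le q(x + t y) + t\, q(-y) \le p(x + t y) - t\, p(y)$ for all $t \ge 0$. Every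
linear functional below it takes the value $p(y)$ at \<open>y\<close>.\<close>

definition tilt :: "('a::real_vector \<Rightarrow> real) \<Rightarrow> 'a \<Rightarrow> 'a \<Rightarrow> real" where
  "tilt p y x = (INF t\<in>{0..}. p (x + t *\<^sub>R y) - t * p y)"

lemma tilt_le:
  assumes p: "sublinear p" and t: "0 \<le> t"
  shows "tilt p y x \<le> p (x + t *\<^sub>R y) - t * p y"
  unfolding tilt_def
proof (rule cINF_lower)
  have "- p (- x) \<le> p (x + t *\<^sub>R y) - t * p y" if "0 \<le> t" for t
    using sublinear_add [OF p, of "x + t *\<^sub>R y" "- x"] sublinear_scaleR [OF p that, of y] by simp
  then show "bdd_below ((\<lambda>t. p (x + t *\<^sub>R y) - t * p y) ` {0..})"
    by (intro bdd_belowI2) auto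
qed (use t in simp)

lemma tilt_greatest:
  "(\<And>t. 0 \<le> t \<Longrightarrow> c \<le> p (x + t *\<^sub>R y) - t * p y) \<Longrightarrow> c \<le> tilt p y x"
  unfolding tilt_def by (rule cINF_greatest) auto

lemma sublinear_tilt:
  assumes p: "sublinear p"
  shows "sublinear (tilt p y)"
proof (rule sublinearI)
  fix x x' :: 'a
  have "tilt p y (x + x') \<le> (p (x + t *\<^sub>R y) - t * p y) + (p (x' + t' *\<^sub>R y) - t' * p y)"
    if "0 \<le> t" "0 \<le> t'" for t t'
    using tilt_le [OF p, of "t + t'" y "x + x'"]
      sublinear_add [OF p, of "x + t *\<^sub>R y" "x' + t' *\<^sub>R y"] that
    by (simp add: algebra_simps)
  then have "tilt p y (x + x') - (p (x' + t' *\<^sub>R y) - t' * p y) \<le> tilt p y x" if "0 \<le> t'" for t'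
    by (intro tilt_greatest) (use that in force)
  then have "tilt p y (x + x') - tilt p y x \<le> tilt p y x'"
    by (intro tilt_greatest) force
  then show "tilt p y (x + x') \<le> tilt p y x + tilt p y x'"
    by simp
next
  have "0 \<le> tilt p y 0"
    by (rule tilt_greatest) (simp add: sublinear_scaleR [OF p])
  then show "tilt p y 0 = 0"
    using tilt_le [OF p, of 0 y 0] by (simp add: sublinear_zero [OF p])
next
  fix s :: real and x
  assume s: "0 < s"
  show "s * tilt p y x \<le> tilt p y (s *\<^sub>R x)"
  proof (rule tilt_greatest)
    fix t :: real
    assume t: "0 \<le> t"
    have "s * tilt p y x \<le> s * (p (x + (t / s) *\<^sub>R y) - t / s * p y)"
      using s t by (intro mult_left_mono tilt_le [OF p]) auto
    also have "\<dots> = p (s *\<^sub>R (x + (t / s) *\<^sub>R y)) - t * p y"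
      using s by (simp add: sublinear_scaleR [OF p] right_diff_distrib)
    also have "\<dots> = p (s *\<^sub>R x + t *\<^sub>R y) - t * p y"
      using s by (simp add: scaleR_add_right)
    finally show "s * tilt p y x \<le> p (s *\<^sub>R x + t *\<^sub>R y) - t * p y" .
  qed
qed

text \<open>Zorn's lemma applies because the pointwise infimum of a chain of sublinear functionals below
\<open>p\<close> is again sublinear: it is finite since each $q \le p$ satisfies
$q(x) \ge -q(-x) \ge -p(-x)$, and subadditive since two members of the chain can be replaced by
the smaller one.\<close>

lemma minimal_sublinear:
  fixes p :: "'a::real_vector \<Rightarrow> real"
  assumes p: "sublinear p"
  obtains f where "sublinear f" "f \<le> p" "\<And>g. sublinear g \<Longrightarrow> g \<le> f \<Longrightarrow> g = f"
proof -
  define A where "A = {q. sublinear q \<and> q \<le> p}"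
  have "\<exists>f\<in>A. \<forall>g\<in>A. g \<le> f \<longrightarrow> g = f"
  proof (rule predicate_Zorn)
    show "partial_order_on A (relation_of (\<lambda>q q'. q' \<le> q) A)"
      by (rule partial_order_on_relation_ofI) auto
  next
    fix C
    assume "C \<in> Chains (relation_of (\<lambda>q q'. q' \<le> q) A)"
    then have chain: "q \<in> A" "q \<le> q' \<or> q' \<le> q" if "q \<in> C" "q' \<in> C" for q q'
      using that by (auto simp: Chains_def relation_of_def)
    show "\<exists>u\<in>A. \<forall>q\<in>C. u \<le> q"
    proof (cases "C = {}")
      case True
      then show ?thesis
        using p by (auto simp: A_def)
    next
      case False
      define u where "u x = (INF q\<in>C. q x)" for x
      have C: "sublinear q" "q x \<le> p x" if "q \<in> C" for q x
        using chain(1) [OF that that] by (auto simp: A_def le_fun_def)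
      have "- p (- x) \<le> q x" if "q \<in> C" for q x
        using sublinear_lower [OF C(1) [OF that], of x] C(2) [OF that, of "- x"] by simp
      then have u_le: "u x \<le> q x" if "q \<in> C" for q x
        unfolding u_def by (intro cINF_lower bdd_belowI2 that)
      have u_greatest: "c \<le> u x" if "\<And>q. q \<in> C \<Longrightarrow> c \<le> q x" for c x
        unfolding u_def by (intro cINF_greatest False that)
      have "sublinear u"
      proof (rule sublinearI)
        fix x y :: 'a
        have "u (x + y) \<le> q x + q' y" if q: "q \<in> C" "q' \<in> C" for q q'
        proof -
          obtain m where m: "m \<in> C" "m \<le> q" "m \<le> q'"
            using chain(2) [OF q] q by auto
          have "u (x + y) \<le> m x + m y"
            using u_le [OF m(1)] sublinear_add [OF C(1) [OF m(1)]] order_trans by blast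
          also have "\<dots> \<le> q x + q' y"
            using m by (intro add_mono) (auto simp: le_fun_def)
          finally show ?thesis .
        qed
        then have "u (x + y) - q' y \<le> u x" if "q' \<in> C" for q'
          by (intro u_greatest) (use that in force)
        then have "u (x + y) - u x \<le> u y"
          by (intro u_greatest) force
        then show "u (x + y) \<le> u x + u y"
          by simp
      next
        show "u 0 = 0"
          using False C(1) by (simp add: u_def sublinear_zero)
      next
        fix t :: real and x
        assume "0 < t"
        then show "t * u x \<le> u (t *\<^sub>R x)"
          by (intro u_greatest) (simp add: sublinear_scaleR C(1) u_le)
      qed
      moreover have "u \<le> p"
      proof (rule le_funI)
        obtain q where "q \<in> C"
          using False by blast
        then show "u x \<le> p x" for x
          using u_le [of q x] C(2) [of q x] by simp
      qed
      ultimately show ?thesis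
        using u_le by (auto simp: A_def le_fun_def)
    qed
  qed
  then obtain f where "f \<in> A" "\<forall>g\<in>A. g \<le> f \<longrightarrow> g = f"
    by blast
  then show thesis
    by (intro that [of f]) (auto simp: A_def)
qed

text \<open>A minimal functional equals all its tilts, and the infimum in \<open>tilt f z x\<close> at $t = 1$ then reads
$f(x) \le f(x + z) - f(z)$. So \<open>f\<close> is additive. Starting below \<open>tilt p y\<close> gives
$f(-y) \le -p(y)$.\<close>

theorem Hahn_Banach_sublinear:
  fixes p :: "'a::real_vector \<Rightarrow> real"
  assumes p: "sublinear p"
  obtains f where "linear f" "\<And>x. f x \<le> p x" "f y = p y"
proof -
  obtain f where f: "sublinear f" "f \<le> tilt p y"
      and minimal: "\<And>g. sublinear g \<Longrightarrow> g \<le> f \<Longrightarrow> g = f"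
    using minimal_sublinear [OF sublinear_tilt [OF p]] by metis
  have tilt_f: "tilt f z = f" for z
    using tilt_le [OF f(1), of 0] by (intro minimal sublinear_tilt f(1) le_funI) simp
  have add: "f (x + z) = f x + f z" for x z
    using tilt_le [OF f(1), of 1 z x] sublinear_add [OF f(1), of x z] by (simp add: tilt_f)
  have minus: "f (- x) = - f x" for x
    using add [of x "- x"] by (simp add: sublinear_zero [OF f(1)])
  have "linear f"
  proof (rule linearI)
    show "f (t *\<^sub>R x) = t *\<^sub>R f x" for t x
      using sublinear_scaleR [OF f(1), of t x] sublinear_scaleR [OF f(1), of "- t" "- x"]
      by (cases "0 \<le> t") (simp_all add: minus)
  qed (rule add)
  moreover have le: "f x \<le> p x" for x
    using le_funD [OF f(2), of x] tilt_le [OF p, of 0 y x] by simp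
  moreover have "f (- y) \<le> - p y"
    using le_funD [OF f(2), of "- y"] tilt_le [OF p, of 1 y "- y"]
    by (simp add: sublinear_zero [OF p])
  then have "f y = p y"
    using le [of y] by (simp add: minus)
  ultimately show thesis
    by (rule that)
qed

lemma norm_preserving_real_functional:
  fixes y :: "'a::real_normed_vector"
  obtains f :: "'a \<Rightarrow> real" where "linear f" "\<And>x. f x \<le> norm x" "f y = norm y"
proof (rule Hahn_Banach_sublinear [of norm y])
  show "sublinear (norm :: 'a \<Rightarrow> real)"
    by (auto simp: sublinear_def norm_triangle_ineq)
qed (use that in blast)

section \<open>The absolute value of the scalar field\<close>

text \<open>The map $J(a + bi) = a + bi$ from the complex numbers to the given field is a homomorphism
with $|J z| \le 2 |z|$. Applied to powers, $|J z|^n = |J (z^n)| \le 2 |z|^n$ for every $n$, so the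
factor $2$ disappears; the inverse of $z$ gives the opposite inequality.\<close>

lemma norm_of_real_add_imaginary:
  fixes i :: "'k::real_normed_field"
  assumes i: "i * i = - 1"
  shows "norm (of_real a + of_real b * i) = sqrt (a\<^sup>2 + b\<^sup>2)"
proof -
  define J where "J z = of_real (Re z) + of_real (Im z) * i" for z
  have mult: "J (z * w) = J z * J w" for z w
  proof -
    have "J z * J w = of_real (Re z * Re w) + of_real (Im z * Im w) * (i * i)
        + of_real (Re z * Im w + Im z * Re w) * i"
      by (simp add: J_def algebra_simps)
    then show ?thesis
      by (simp add: J_def i)
  qed
  have one: "J 1 = 1"
    by (simp add: J_def)
  have power: "J (z ^ n) = J z ^ n" for z n
    by (induction n) (simp_all add: one mult)
  have "norm i * norm i = 1"
    using i by (metis norm_minus_cancel norm_mult norm_one)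
  then have norm_i: "norm i = 1"
    using norm_ge_zero [of i] by (metis abs_of_nonneg abs_square_eq_1 power2_eq_square)
  have two: "norm (J z) \<le> 2 * norm z" for z
  proof -
    have "norm (J z) \<le> \<bar>Re z\<bar> + \<bar>Im z\<bar>"
      unfolding J_def by (rule order_trans [OF norm_triangle_ineq]) (simp add: norm_mult norm_i)
    then show ?thesis
      using abs_Re_le_cmod [of z] abs_Im_le_cmod [of z] by linarith
  qed
  have le: "norm (J z) \<le> norm z" for z
  proof (rule ccontr)
    assume less: "\<not> norm (J z) \<le> norm z"
    then have "z \<noteq> 0"
      using two [of z] by auto
    then have pos: "0 < norm z"
      by simp
    then obtain n where "2 < (norm (J z) / norm z) ^ n"
      using less real_arch_pow [of "norm (J z) / norm z" 2] by auto
    then have "2 * norm z ^ n < norm (J z) ^ n"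
      using pos by (simp add: power_divide pos_less_divide_eq)
    then show False
      using two [of "z ^ n"] by (simp add: power norm_power)
  qed
  have ge: "norm z \<le> norm (J z)" for z
  proof (cases "z = 0")
    case False
    then have "1 = norm (J z) * norm (J (inverse z))"
      by (simp add: one flip: norm_mult mult)
    also have "\<dots> \<le> norm (J z) * norm (inverse z)"
      by (intro mult_left_mono le) simp
    finally have "1 \<le> norm (J z) / norm z"
      by (simp only: norm_inverse divide_inverse)
    then show ?thesis
      using False by (simp add: pos_le_divide_eq)
  qed simp
  show ?thesis
    using le [of "Complex a b"] ge [of "Complex a b"] by (simp add: J_def cmod_def)
qed

section \<open>Functionals and the dual space\<close>

lemma functionals_scale_real:
  assumes "h \<in> functionals V smul" "v \<in> V" "smul (of_real t) v = t *\<^sub>R v"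
  shows "h (t *\<^sub>R v) = t *\<^sub>R h v"
proof -
  have "h (smul (of_real t) v) = of_real t * h v"
    using assms(1,2) unfolding functionals_def by blast
  then show ?thesis
    by (simp add: assms(3) scaleR_conv_of_real)
qed

text \<open>The norm of a functional is a supremum over the unit ball of \<open>V\<close>. It controls all of \<open>V\<close> as soon as
vectors can be normalised inside \<open>V\<close> and the scalars of $K$ restrict to the real ones.\<close>

lemma functional_le_functional_norm:
  assumes h: "h \<in> functionals V smul" and v: "v \<in> V"
    and real: "\<And>t v. v \<in> V \<Longrightarrow> smul (of_real t) v = t *\<^sub>R v"
    and closed: "\<And>t v. v \<in> V \<Longrightarrow> t *\<^sub>R v \<in> V"
  shows "norm (h v) \<le> functional_norm V h * norm v"
proof -
  have scale: "h (t *\<^sub>R v) = t *\<^sub>R h v" for t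
    by (intro functionals_scale_real [OF h v] real v)
  show ?thesis
  proof (cases "v = 0")
    case True
    then show ?thesis
      using scale [of 0] by simp
  next
    case False
    obtain C where C: "norm (h x) \<le> C * norm x" if "x \<in> V" for x
      using h unfolding functionals_def by blast
    have "norm (h x) \<le> \<bar>C\<bar>" if "x \<in> V" "norm x \<le> 1" for x
    proof -
      have "norm (h x) \<le> \<bar>C\<bar> * norm x"
        using C [OF that(1)] by (rule order_trans) (simp add: mult_right_mono)
      also have "\<dots> \<le> \<bar>C\<bar> * 1"
        using that(2) by (intro mult_left_mono) auto
      finally show ?thesis by simp
    qed
    then have "norm (h (inverse (norm v) *\<^sub>R v)) \<le> functional_norm V h"
      unfolding functional_norm_def
      by (intro cSUP_upper bdd_aboveI2 [where M = "\<bar>C\<bar>"]) (use v closed False in auto)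
    then show ?thesis
      using False by (simp add: scale field_simps)
  qed
qed

lemma dual_zero: "0 \<in> dual smul"
  by (simp add: dual_def)

lemma dual_add: "f \<in> dual smul \<Longrightarrow> g \<in> dual smul \<Longrightarrow> f + g \<in> dual smul"
  by (simp add: dual_def blinfun.add_left distrib_left)

lemma dual_scale_apply: "blinfun_apply (dual_scale c f) x = c * blinfun_apply f x"
  by (simp add: dual_scale_def)

lemma dual_scale_in_dual: "f \<in> dual smul \<Longrightarrow> dual_scale c f \<in> dual smul"
  by (simp add: dual_def dual_scale_apply)

lemma dual_scale_of_real: "dual_scale (of_real t) f = t *\<^sub>R f"
  by (rule blinfun_eqI) (simp add: dual_scale_apply blinfun.scaleR_left scaleR_conv_of_real)

lemma functionals_dual_sum:
  assumes h: "h \<in> functionals (dual smul) dual_scale" and "finite F"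
    and \<psi>: "\<And>k. k \<in> F \<Longrightarrow> \<psi> k \<in> dual smul"
  shows "(\<Sum>k\<in>F. dual_scale (c k) (\<psi> k)) \<in> dual smul \<and>
    h (\<Sum>k\<in>F. dual_scale (c k) (\<psi> k)) = (\<Sum>k\<in>F. c k * h (\<psi> k))"
  using \<open>finite F\<close> \<psi>
proof (induction F)
  case empty
  have "h (0 *\<^sub>R 0) = 0 *\<^sub>R h 0"
    by (intro functionals_scale_real [OF h] dual_scale_of_real dual_zero)
  then show ?case
    by (simp add: dual_zero)
next
  case (insert k F)
  then have "dual_scale (c k) (\<psi> k) \<in> dual smul" "\<psi> k \<in> dual smul"
    by (simp_all add: dual_scale_in_dual)
  with insert show ?case
    using h by (simp add: dual_add functionals_def)
qed

section \<open>Bessel sequences are weakly summable\<close>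

text \<open>By \<open>powr_sum_le_if_pairing_le\<close> it suffices to bound $\sum_{k \in F} c_k h(\psi_k) = h(f)$ with
$f = \sum_{k \in F} c_k \psi_k$. Here \<open>f\<close> is an element of the dual whose norm is computed on
vectors, where the Bessel condition applies.\<close>

lemma functional_of_bessel_bounded:
  fixes \<psi> :: "'i \<Rightarrow> 'a::real_normed_vector \<Rightarrow>\<^sub>L 'k::real_or_complex"
  assumes pq: "1 < p" "1 < q" "1 / p + 1 / q = 1"
    and \<psi>: "bessel p I UNIV smul (\<lambda>k. blinfun_apply (\<psi> k)) B"
    and h: "h \<in> functionals (dual smul) dual_scale"
    and C: "0 \<le> C" "\<And>f. f \<in> dual smul \<Longrightarrow> norm (h f) \<le> C * norm f"
  shows "in_lp (ennreal p) I (\<lambda>k. h (\<psi> k))" and "lp_norm (ennreal p) I (\<lambda>k. h (\<psi> k)) \<le> C * B"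
proof -
  have B: "0 < B"
    using \<psi> by (simp add: bessel_def)
  have \<psi>_dual: "\<psi> k \<in> dual smul" if "k \<in> I" for k
    using \<psi> that by (simp add: bessel_def functionals_def dual_def)
  have "(\<Sum>k\<in>F. norm (h (\<psi> k)) powr p) powr (1 / p) \<le> C * B" if F: "finite F" "F \<subseteq> I" for F
  proof (rule powr_sum_le_if_pairing_le [OF pq])
    fix c :: "'i \<Rightarrow> 'k"
    define f where "f = (\<Sum>k\<in>F. dual_scale (c k) (\<psi> k))"
    define N where "N = (\<Sum>k\<in>F. norm (c k) powr q) powr (1 / q)"
    have "norm (blinfun_apply f x) \<le> (N * B) * norm x" for x
    proof -
      have "norm (blinfun_apply f x) \<le> (\<Sum>k\<in>F. norm (c k) * norm (blinfun_apply (\<psi> k) x))"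
        unfolding f_def blinfun.sum_left
        by (rule order_trans [OF norm_sum]) (simp add: dual_scale_apply norm_mult)
      also have "\<dots> \<le> N * (\<Sum>k\<in>F. norm (blinfun_apply (\<psi> k) x) powr p) powr (1 / p)"
        unfolding N_def using pq by (intro Hoelder_sum) auto
      also have "\<dots> \<le> N * lp_norm (ennreal p) I (\<lambda>k. blinfun_apply (\<psi> k) x)"
        using \<psi> pq F by (intro mult_left_mono finite_lp_sum_le_lp_norm) (auto simp: bessel_def N_def)
      also have "\<dots> \<le> N * (B * norm x)"
        using \<psi> by (intro mult_left_mono) (auto simp: bessel_def N_def)
      finally show ?thesis
        by (simp add: mult.assoc)
    qed
    then have norm_f: "norm f \<le> N * B"
      by (intro norm_blinfun_bound) (use B in \<open>auto simp: N_def\<close>)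
    have "f \<in> dual smul" and hf: "h f = (\<Sum>k\<in>F. c k * h (\<psi> k))"
      using functionals_dual_sum [OF h F(1), of \<psi> c] \<psi>_dual F(2) by (auto simp: f_def)
    then have "norm (\<Sum>k\<in>F. c k * h (\<psi> k)) \<le> C * norm f"
      using C(2) by metis
    also have "\<dots> \<le> C * (N * B)"
      by (intro mult_left_mono norm_f C)
    finally show "norm (\<Sum>k\<in>F. c k * h (\<psi> k)) \<le> C * B * (\<Sum>k\<in>F. norm (c k) powr q) powr (1 / q)"
      by (simp add: N_def mult_ac)
  qed (use B C in simp)
  then show "in_lp (ennreal p) I (\<lambda>k. h (\<psi> k))"
      and "lp_norm (ennreal p) I (\<lambda>k. h (\<psi> k)) \<le> C * B"
    using pq B C by (simp_all add: lp_if_finite_sums_bounded [where C = "C * B"])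
qed

context banach_space_over
begin

lemma functional_imp_blinfun:
  assumes h: "h \<in> functionals UNIV smul"
    and C: "0 \<le> C" "\<And>x. norm (h x) \<le> C * norm x"
  obtains f where "f \<in> dual smul" "blinfun_apply f = h" "norm f \<le> C"
proof -
  have "bounded_linear h"
  proof (rule bounded_linear_intro)
    show "h (t *\<^sub>R x) = t *\<^sub>R h x" for t x
      by (intro functionals_scale_real [OF h] scale_of_real) simp
  qed (use h C in \<open>auto simp: functionals_def mult.commute\<close>)
  then have "blinfun_apply (Blinfun h) = h"
    by (rule bounded_linear_Blinfun_apply)
  then show thesis
    using h C by (intro that [of "Blinfun h"] norm_blinfun_bound)
      (auto simp: dual_def functionals_def)
qed

lemma functional_of_dual_bessel_bounded:
  assumes \<phi>: "bessel q I (dual smul) dual_scale (\<lambda>k h. blinfun_apply h (\<phi> k)) B"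
    and h: "h \<in> functionals UNIV smul"
    and C: "0 \<le> C" "\<And>x. norm (h x) \<le> C * norm x"
  shows "in_lp (ennreal q) I (\<lambda>k. h (\<phi> k))" and "lp_norm (ennreal q) I (\<lambda>k. h (\<phi> k)) \<le> C * B"
proof -
  obtain f where f: "f \<in> dual smul" "blinfun_apply f = h" "norm f \<le> C"
    using functional_imp_blinfun [OF h C] .
  then show "in_lp (ennreal q) I (\<lambda>k. h (\<phi> k))"
    using \<phi> by (auto simp: bessel_def)
  have "lp_norm (ennreal q) I (\<lambda>k. h (\<phi> k)) \<le> B * norm f"
    using f \<phi> by (auto simp: bessel_def)
  also have "\<dots> \<le> C * B"
    using f \<phi> by (simp add: bessel_def mult.commute mult_left_mono)
  finally show "lp_norm (ennreal q) I (\<lambda>k. h (\<phi> k)) \<le> C * B" .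
qed

section \<open>Norming functionals and the convergence of synthesis series\<close>

text \<open>In the complex case the real functional \<open>f\<close> is completed to $h(x) = f(x) - i f(i x)$, whose real
part is \<open>f\<close>. This gives $|h(y)| \ge f(y) = \|y\|$. For the upper bound, multiply \<open>x\<close> by a scalar
of modulus one that makes the value of \<open>h\<close> real and nonnegative; there \<open>h\<close> agrees with \<open>f\<close>.\<close>

lemma norming_functional:
  obtains h where "h \<in> functionals UNIV smul" "\<And>x. norm (h x) \<le> norm x" "norm y \<le> norm (h y)"
proof -
  obtain f :: "'a \<Rightarrow> real" where f: "linear f" "\<And>x. f x \<le> norm x" "f y = norm y"
    using norm_preserving_real_functional by blast
  note f_simps = linear_add [OF f(1)] linear_scale [OF f(1)] linear_neg [OF f(1)] linear_diff [OF f(1)]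
  have abs_f: "\<bar>f x\<bar> \<le> norm x" for x
    using f(2) [of x] f(2) [of "- x"] by (simp add: f_simps)
  consider "\<And>z::'k. \<exists>a. z = a *\<^sub>R 1"
    | i :: 'k where "i * i = - 1" "\<And>z. \<exists>a b. z = a *\<^sub>R 1 + b *\<^sub>R i"
    using real_or_complex by metis
  then show thesis
  proof cases
    case 1
    show thesis
    proof (rule that)
      have "of_real (f (smul c x)) = c * of_real (f x)" for c x
      proof -
        obtain a where "c = of_real a"
          using 1 [of c] by (auto simp: of_real_def)
        then show ?thesis
          by (simp add: scale_of_real f_simps)
      qed
      then show "(\<lambda>x. of_real (f x)) \<in> functionals UNIV smul"
        by (auto simp: functionals_def f_simps intro!: exI [of _ 1] abs_f)
    qed (use abs_f f(3) in auto)
  next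
    case (2 i)
    define h where "h x = of_real (f x) + of_real (- f (smul i x)) * i" for x
    have norm_h: "norm (h x) = sqrt ((f x)\<^sup>2 + (f (smul i x))\<^sup>2)" for x
      using norm_of_real_add_imaginary [OF 2(1), of "f x" "- f (smul i x)"] by (simp add: h_def)
    have h_add: "h (x + x') = h x + h x'" for x x'
      by (simp add: h_def scale_right_distrib f_simps algebra_simps)
    have h_scale: "h (smul c x) = c * h x" for c x
    proof -
      obtain a b where c: "c = of_real a + of_real b * i"
        using 2(2) [of c] by (auto simp: scaleR_conv_of_real)
      have cx: "smul c x = a *\<^sub>R x + b *\<^sub>R smul i x"
        by (simp add: c scale_left_distrib scale_of_real flip: scale_scale)
      have "i * c = of_real a * i + of_real b * (i * i)"
        by (simp add: c algebra_simps)
      then have "i * c = of_real a * i + of_real (- b)"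
        by (simp add: 2(1))
      then have icx: "smul i (smul c x) = a *\<^sub>R smul i x + (- b) *\<^sub>R x"
        by (simp only: scale_scale scale_left_distrib scale_of_real)
          (simp add: scale_of_real flip: scale_scale)
      have "c * h x = of_real (a * f x + b * f (smul i x)) * 1
          + of_real (b * f x - a * f (smul i x)) * i"
      proof -
        have "c * h x = of_real (a * f x) - of_real (b * f (smul i x)) * (i * i)
            + of_real (b * f x - a * f (smul i x)) * i"
          by (simp add: c h_def algebra_simps)
        then show ?thesis
          by (simp add: 2(1))
      qed
      then show ?thesis
        unfolding h_def icx unfolding cx by (simp add: f_simps algebra_simps)
    qed
    have le: "norm (h x) \<le> norm x" for x
    proof (cases "h x = 0")
      case False
      \<comment> \<open>the phase that turns \<open>h x\<close> into its modulus\<close>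
      define c where "c = of_real (norm (h x)) / h x"
      have "h (smul c x) = of_real (norm (h x))"
        using False by (simp add: h_scale c_def)
      then have "of_real (f (smul c x) - norm (h x)) + of_real (- f (smul i (smul c x))) * i = 0"
        by (simp add: h_def [of "smul c x"] algebra_simps)
      then have "norm (h x) = f (smul c x)"
        using norm_of_real_add_imaginary [OF 2(1), of "f (smul c x) - norm (h x)"
            "- f (smul i (smul c x))"]
        by (simp add: sum_power2_eq_zero_iff)
      also have "\<dots> \<le> norm (smul c x)"
        by (rule f)
      also have "\<dots> = norm x"
        using False by (simp add: norm_scale c_def norm_divide)
      finally show ?thesis .
    qed simp
    show thesis
    proof (rule that)
      show "h \<in> functionals UNIV smul"
        by (auto simp: functionals_def h_add h_scale intro!: exI [of _ 1] le)
      show "norm y \<le> norm (h y)"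
        by (simp add: norm_h f(3) real_le_rsqrt)
    qed (rule le)
  qed
qed

text \<open>A norming functional reduces the estimate to scalars, where it is the inequality of Hoelder for the
coefficients and the Bessel condition for the vectors.\<close>

lemma synthesis_bound:
  assumes pq: "1 < p" "1 < q" "1 / p + 1 / q = 1"
    and \<phi>: "bessel q I (dual smul) dual_scale (\<lambda>k h. blinfun_apply h (\<phi> k)) B"
    and F: "finite F" "F \<subseteq> I"
  shows "norm (\<Sum>k\<in>F. smul (a k) (\<phi> k)) \<le> B * (\<Sum>k\<in>F. norm (a k) powr p) powr (1 / p)"
proof -
  define y where "y = (\<Sum>k\<in>F. smul (a k) (\<phi> k))"
  define N where "N = (\<Sum>k\<in>F. norm (a k) powr p) powr (1 / p)"
  obtain h where h: "h \<in> functionals UNIV smul" "\<And>x. norm (h x) \<le> norm x" "norm y \<le> norm (h y)"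
    using norming_functional by blast
  have h_sum: "h (\<Sum>k\<in>F. smul (a k) (\<phi> k)) = (\<Sum>k\<in>F. a k * h (\<phi> k))"
    using F(1)
  proof induction
    case empty
    show ?case
      using h(2) [of 0] by simp
  qed (use h(1) in \<open>simp add: functionals_def\<close>)
  have "norm y \<le> (\<Sum>k\<in>F. norm (a k) * norm (h (\<phi> k)))"
    using h(3) unfolding y_def h_sum
    by (rule order_trans) (simp add: sum_norm_le norm_mult)
  also have "\<dots> \<le> N * (\<Sum>k\<in>F. norm (h (\<phi> k)) powr q) powr (1 / q)"
    unfolding N_def using pq by (intro Hoelder_sum) auto
  also have "\<dots> \<le> N * lp_norm (ennreal q) I (\<lambda>k. h (\<phi> k))"
    using functional_of_dual_bessel_bounded [OF \<phi> h(1), of 1] h(2) pq F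
    by (intro mult_left_mono finite_lp_sum_le_lp_norm) (auto simp: N_def)
  also have "\<dots> \<le> N * B"
    using functional_of_dual_bessel_bounded [OF \<phi> h(1), of 1] h(2)
    by (intro mult_left_mono) (auto simp: N_def)
  finally show ?thesis
    by (simp add: y_def N_def mult.commute)
qed

text \<open>By \<open>synthesis_bound\<close> a sum over a finite set disjoint from \<open>F0\<close> is controlled by the $\ell^p$ tail of
the coefficients, and the same bound passes to the limit for the whole sum.\<close>

lemma synthesis_summable:
  assumes pq: "1 < p" "1 < q" "1 / p + 1 / q = 1"
    and \<phi>: "bessel q I (dual smul) dual_scale (\<lambda>k h. blinfun_apply h (\<phi> k)) B"
    and a: "in_lp (ennreal p) I a"
  shows "(\<lambda>k. smul (a k) (\<phi> k)) summable_on I"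
    and "norm (\<Sum>\<^sub>\<infinity>k\<in>I. smul (a k) (\<phi> k)) \<le> B * lp_norm (ennreal p) I a"
proof -
  have B: "0 < B"
    using \<phi> by (simp add: bessel_def)
  have p: "0 < p"
    using pq by simp
  have a_summable: "(\<lambda>k. norm (a k) powr p) summable_on I"
    using a by (simp add: in_lp_ennreal p)
  show summable: "(\<lambda>k. smul (a k) (\<phi> k)) summable_on I"
  proof (rule summable_on_if_small_tails)
    fix e :: real
    assume e: "0 < e"
    \<comment> \<open>chosen so that a tail of mass \<open>d\<close> contributes at most \<open>e / 2\<close>\<close>
    define d where "d = (e / (2 * B)) powr p"
    have "0 < d"
      using e B by (simp add: d_def)
    then obtain F0 where F0: "finite F0" "F0 \<subseteq> I"
        and approx: "dist (\<Sum>k\<in>F0. norm (a k) powr p) (\<Sum>\<^sub>\<infinity>k\<in>I. norm (a k) powr p) \<le> d"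
      using infsum_finite_approximation [OF a_summable] by blast
    have "norm (\<Sum>k\<in>G. smul (a k) (\<phi> k)) < e" if G: "finite G" "G \<subseteq> I - F0" for G
    proof -
      have "(\<Sum>k\<in>F0. norm (a k) powr p) + (\<Sum>k\<in>G. norm (a k) powr p)
          = (\<Sum>k\<in>F0 \<union> G. norm (a k) powr p)"
        using F0 G by (intro sum.union_disjoint [symmetric]) auto
      also have "\<dots> \<le> (\<Sum>\<^sub>\<infinity>k\<in>I. norm (a k) powr p)"
        using F0 G by (intro finite_sum_le_infsum a_summable) auto
      finally have "(\<Sum>k\<in>G. norm (a k) powr p) \<le> d"
        using approx by (simp add: dist_real_def)
      then have "(\<Sum>k\<in>G. norm (a k) powr p) powr (1 / p) \<le> d powr (1 / p)"
        using p by (intro powr_mono2) (auto intro: sum_nonneg)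
      also have "\<dots> = e / (2 * B)"
        using e B p by (simp add: d_def powr_powr)
      finally have "B * (\<Sum>k\<in>G. norm (a k) powr p) powr (1 / p) \<le> e / 2"
        using B by (simp add: field_simps)
      moreover have "norm (\<Sum>k\<in>G. smul (a k) (\<phi> k))
          \<le> B * (\<Sum>k\<in>G. norm (a k) powr p) powr (1 / p)"
        using G by (intro synthesis_bound [OF pq \<phi>]) auto
      ultimately show ?thesis
        using e by simp
    qed
    then show "\<exists>F0. finite F0 \<and> F0 \<subseteq> I \<and>
        (\<forall>G. finite G \<longrightarrow> G \<subseteq> I - F0 \<longrightarrow> norm (\<Sum>k\<in>G. smul (a k) (\<phi> k)) < e)"
      using F0 by blast
  qed
  have "((\<lambda>F. norm (\<Sum>k\<in>F. smul (a k) (\<phi> k))) \<longlongrightarrow> norm (\<Sum>\<^sub>\<infinity>k\<in>I. smul (a k) (\<phi> k)))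
      (finite_subsets_at_top I)"
    by (intro tendsto_norm infsum_tendsto summable)
  moreover have "norm (\<Sum>k\<in>F. smul (a k) (\<phi> k)) \<le> B * lp_norm (ennreal p) I a"
    if F: "finite F" "F \<subseteq> I" for F
    using synthesis_bound [OF pq \<phi> F, of a] finite_lp_sum_le_lp_norm [OF p a F] B
    by (meson less_imp_le mult_left_mono order_trans)
  then have "\<forall>\<^sub>F F in finite_subsets_at_top I.
      norm (\<Sum>k\<in>F. smul (a k) (\<phi> k)) \<le> B * lp_norm (ennreal p) I a"
    by (intro eventually_finite_subsets_at_top_weakI)
  ultimately show "norm (\<Sum>\<^sub>\<infinity>k\<in>I. smul (a k) (\<phi> k)) \<le> B * lp_norm (ennreal p) I a"
    by (rule tendsto_upperbound) simp
qed

end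

section \<open>Transport to the natural numbers\<close>

text \<open>For finite \<open>I\<close> the enumeration does not exhaust the natural numbers, and so the family is extended by
zero outside the image of \<open>I\<close>.\<close>

definition pad :: "'i set \<Rightarrow> ('i \<Rightarrow> 'v::zero) \<Rightarrow> nat \<Rightarrow> 'v" where
  "pad I x n = (if n \<in> to_nat_on I ` I then x (from_nat_into I n) else 0)"

lemma pad_apply: "g 0 = 0 \<Longrightarrow> g (pad I x n) = pad I (\<lambda>k. g (x k)) n"
  by (simp add: pad_def)

lemma has_sum_pad:
  fixes x :: "'i \<Rightarrow> 'v::{comm_monoid_add, t2_space}"
  assumes I: "countable I"
  shows "(pad I x has_sum S) UNIV \<longleftrightarrow> (x has_sum S) I"
proof -
  have "(pad I x has_sum S) UNIV \<longleftrightarrow> (pad I x has_sum S) (to_nat_on I ` I)"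
    by (rule has_sum_cong_neutral) (auto simp: pad_def)
  also have "\<dots> \<longleftrightarrow> ((pad I x \<circ> to_nat_on I) has_sum S) I"
    by (rule has_sum_reindex) (rule inj_on_to_nat_on [OF I])
  also have "\<dots> \<longleftrightarrow> (x has_sum S) I"
    by (rule has_sum_cong) (simp add: pad_def I)
  finally show ?thesis .
qed

lemma infsum_pad:
  fixes x :: "'i \<Rightarrow> 'v::{comm_monoid_add, t2_space}"
  assumes I: "countable I"
  shows "infsum (pad I x) UNIV = infsum x I"
proof (cases "x summable_on I")
  case True
  then show ?thesis
    by (intro infsumI) (simp add: has_sum_pad I)
next
  case False
  then show ?thesis
    by (simp add: infsum_not_exists summable_on_def has_sum_pad I)
qed

lemma lp_pad:
  assumes I: "countable I" and s: "0 < s"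
  shows "in_lp (ennreal s) UNIV (pad I a) \<longleftrightarrow> in_lp (ennreal s) I a"
    and "lp_norm (ennreal s) UNIV (pad I a) = lp_norm (ennreal s) I a"
proof -
  have *: "norm (pad I a n) powr s = pad I (\<lambda>k. norm (a k) powr s) n" for n
    by (rule pad_apply) simp
  show "in_lp (ennreal s) UNIV (pad I a) \<longleftrightarrow> in_lp (ennreal s) I a"
    by (simp add: in_lp_ennreal s * summable_on_def has_sum_pad I)
  show "lp_norm (ennreal s) UNIV (pad I a) = lp_norm (ennreal s) I a"
    by (simp add: lp_norm_ennreal s * infsum_pad I)
qed

text \<open>The hypothesis \<open>bound\<close> asks for the weak estimate with every constant \<open>C\<close> that dominates \<open>h\<close>. The
mere boundedness of \<open>h\<close> then gives weak summability, and $C = 1$ gives the weak norm.\<close>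

lemma weak_summability_pad:
  assumes I: "countable I" and s: "0 < s" and B: "0 \<le> B"
    and V: "0 \<in> V" "\<And>k. k \<in> I \<Longrightarrow> x k \<in> V"
    and real: "\<And>t v. v \<in> V \<Longrightarrow> smul (of_real t) v = t *\<^sub>R v"
    and closed: "\<And>t v. v \<in> V \<Longrightarrow> t *\<^sub>R v \<in> V"
    and bound: "\<And>h C. h \<in> functionals V smul \<Longrightarrow> 0 \<le> C \<Longrightarrow>
      (\<And>v. v \<in> V \<Longrightarrow> norm (h v) \<le> C * norm v) \<Longrightarrow>
      in_lp (ennreal s) I (\<lambda>k. h (x k)) \<and> lp_norm (ennreal s) I (\<lambda>k. h (x k)) \<le> C * B"
  shows "weakly_summable (ennreal s) V smul (pad I x)"
    and "weak_norm (ennreal s) V smul (pad I x) \<le> ennreal B"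
proof -
  have h_pad: "(\<lambda>n. h (pad I x n)) = pad I (\<lambda>k. h (x k))" if h: "h \<in> functionals V smul" for h
  proof -
    have "h (0 *\<^sub>R 0) = 0 *\<^sub>R h 0"
      by (intro functionals_scale_real [OF h] real V)
    then show ?thesis
      by (intro ext pad_apply) simp
  qed
  show "weakly_summable (ennreal s) V smul (pad I x)"
    unfolding weakly_summable_def
  proof (intro conjI allI ballI)
    show "pad I x n \<in> V" for n
      using V by (auto simp: pad_def I)
    fix h
    assume h: "h \<in> functionals V smul"
    then obtain C where C: "norm (h v) \<le> C * norm v" if "v \<in> V" for v
      unfolding functionals_def by blast
    have "norm (h v) \<le> \<bar>C\<bar> * norm v" if "v \<in> V" for v
      using C [OF that] by (rule order_trans) (simp add: mult_right_mono)
    then show "in_lp (ennreal s) UNIV (\<lambda>n. h (pad I x n))"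
      using bound [OF h, of "\<bar>C\<bar>"] by (simp add: h_pad [OF h] lp_pad I s)
  qed
  show "weak_norm (ennreal s) V smul (pad I x) \<le> ennreal B"
    unfolding weak_norm_def
  proof (rule SUP_least)
    fix h
    assume "h \<in> {h \<in> functionals V smul. functional_norm V h \<le> 1}"
    then have h: "h \<in> functionals V smul" and h1: "functional_norm V h \<le> 1"
      by auto
    have "norm (h v) \<le> 1 * norm v" if "v \<in> V" for v
      using functional_le_functional_norm [OF h that real closed] h1
      by (meson mult_right_mono norm_ge_zero order_trans)
    then have "lp_norm (ennreal s) UNIV (\<lambda>n. h (pad I x n)) \<le> B"
      using bound [OF h, of 1] by (simp add: h_pad [OF h] lp_pad I s)
    then show "ennreal (lp_norm (ennreal s) UNIV (\<lambda>n. h (pad I x n))) \<le> ennreal B"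
      by (rule ennreal_leI)
  qed
qed

lemma conjugate_exponent_ennreal:
  assumes "1 < p" "1 < q" "1 / p + 1 / q = 1"
  shows "conjugate_exponent (ennreal p) = ennreal q"
proof -
  have "1 - inverse (ennreal p) = ennreal (1 - inverse p)"
    using assms by (simp add: inverse_ennreal ennreal_minus flip: ennreal_1)
  also have "1 - inverse p = inverse q"
    using assms by (simp add: field_simps)
  finally show ?thesis
    using assms by (simp add: conjugate_exponent_def inverse_ennreal)
qed

section \<open>Multipliers of Bessel sequences\<close>

theorem corollary3p3:
  fixes scaleX :: "'k::real_or_complex \<Rightarrow> 'a::banach \<Rightarrow> 'a"
    and scaleY :: "'k \<Rightarrow> 'b::banach \<Rightarrow> 'b"
    and I :: "'i set"
    and \<psi> :: "'i \<Rightarrow> 'a \<Rightarrow>\<^sub>L 'k" and \<phi> :: "'i \<Rightarrow> 'b" and m :: "'i \<Rightarrow> 'k"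
    and p q r B1 B2 :: real
  assumes "p > 0" and "q > 0" and "1 / p + 1 / q = 1"
    and "banach_space_over scaleX" and "banach_space_over scaleY"
    and "separable_space (euclidean :: 'a topology)"
    and "separable_space (euclidean :: 'b topology)"
    and "reflexive scaleX" and "reflexive scaleY"
    and "countable I"
    and "bessel p I UNIV scaleX (\<lambda>k. blinfun_apply (\<psi> k)) B1"
    and "bessel q I (dual scaleY) dual_scale (\<lambda>k h. blinfun_apply h (\<phi> k)) B2"
    and "r > 0" and "in_lp (ennreal r) I m"
  shows "(\<forall>f. (\<lambda>k. scaleY (m k * blinfun_apply (\<psi> k) f) (\<phi> k)) summable_on I) \<and>
    nuclear (ennreal r) (ennreal p) (ennreal q) scaleX scaleY (multiplier I scaleY m \<phi> \<psi>) \<and>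
    nuclear_norm (ennreal r) (ennreal p) (ennreal q) scaleX scaleY (multiplier I scaleY m \<phi> \<psi>)
      \<le> ennreal (B1 * B2 * lp_norm (ennreal r) I m)"
proof -
  interpret X: banach_space_over scaleX by fact
  interpret Y: banach_space_over scaleY by fact
  note I = \<open>countable I\<close> and r = \<open>r > 0\<close> and m = \<open>in_lp (ennreal r) I m\<close>
  note \<psi> = \<open>bessel p I UNIV scaleX (\<lambda>k. blinfun_apply (\<psi> k)) B1\<close>
    and \<phi> = \<open>bessel q I (dual scaleY) dual_scale (\<lambda>k h. blinfun_apply h (\<phi> k)) B2\<close>
  have pq: "1 < p" "1 < q" "1 / p + 1 / q = 1" and B: "0 < B1" "0 < B2"
    using assms(3) \<psi> \<phi> by (auto simp: bessel_def)
  have qp: "1 / q + 1 / p = 1"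
    using pq by simp
  have \<psi>_dual: "\<psi> k \<in> dual scaleX" if "k \<in> I" for k
    using \<psi> that by (simp add: bessel_def functionals_def dual_def)
  define M where "M = multiplier I scaleY m \<phi> \<psi>"
  obtain K where K: "0 \<le> K" "\<And>k. k \<in> I \<Longrightarrow> norm (m k) \<le> K"
    using in_lp_bounded [OF r m] by blast

  \<comment> \<open>an $\ell^r$ family is bounded, so $|m_k|$ can be replaced by the constant \<open>K\<close>\<close>
  have coeff: "in_lp (ennreal p) I (\<lambda>k. m k * blinfun_apply (\<psi> k) f)"
      "lp_norm (ennreal p) I (\<lambda>k. m k * blinfun_apply (\<psi> k) f) \<le> K * (B1 * norm f)" for f
  proof -
    have "(\<Sum>k\<in>F. norm (m k * blinfun_apply (\<psi> k) f) powr p) powr (1 / p) \<le> K * (B1 * norm f)"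
      if F: "finite F" "F \<subseteq> I" for F
    proof -
      have "(\<Sum>k\<in>F. norm (m k * blinfun_apply (\<psi> k) f) powr p)
          \<le> (\<Sum>k\<in>F. (K * norm (blinfun_apply (\<psi> k) f)) powr p)"
        using K F pq by (intro sum_mono powr_mono2) (auto simp: norm_mult intro!: mult_right_mono)
      also have "\<dots> = K powr p * (\<Sum>k\<in>F. norm (blinfun_apply (\<psi> k) f) powr p)"
        using K by (simp add: powr_mult sum_distrib_left)
      finally have "(\<Sum>k\<in>F. norm (m k * blinfun_apply (\<psi> k) f) powr p) powr (1 / p)
          \<le> (K powr p * (\<Sum>k\<in>F. norm (blinfun_apply (\<psi> k) f) powr p)) powr (1 / p)"
        using pq by (intro powr_mono2) (auto intro: sum_nonneg)
      also have "\<dots> = K * (\<Sum>k\<in>F. norm (blinfun_apply (\<psi> k) f) powr p) powr (1 / p)"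
        using K pq by (simp add: powr_mult powr_powr sum_nonneg)
      also have "\<dots> \<le> K * lp_norm (ennreal p) I (\<lambda>k. blinfun_apply (\<psi> k) f)"
        using K pq \<psi> F by (intro mult_left_mono finite_lp_sum_le_lp_norm) (auto simp: bessel_def)
      also have "\<dots> \<le> K * (B1 * norm f)"
        using K \<psi> by (intro mult_left_mono) (auto simp: bessel_def)
      finally show ?thesis .
    qed
    then show "in_lp (ennreal p) I (\<lambda>k. m k * blinfun_apply (\<psi> k) f)"
        "lp_norm (ennreal p) I (\<lambda>k. m k * blinfun_apply (\<psi> k) f) \<le> K * (B1 * norm f)"
      using pq K B by (simp_all add: lp_if_finite_sums_bounded [where C = "K * (B1 * norm f)"])
  qed
  have summable: "(\<lambda>k. scaleY (m k * blinfun_apply (\<psi> k) f) (\<phi> k)) summable_on I" for f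
    by (rule Y.synthesis_summable [OF pq \<phi> coeff(1)])
  then have has_sum_M: "((\<lambda>k. scaleY (m k * blinfun_apply (\<psi> k) f) (\<phi> k)) has_sum M f) I" for f
    by (simp add: M_def multiplier_def)

  have M_scale: "M (scaleX c f) = scaleY c (M f)" for c f
  proof (rule has_sum_unique [OF has_sum_M])
    have "bounded_linear (scaleY c)"
    proof (rule bounded_linear_intro)
      show "scaleY c (t *\<^sub>R x) = t *\<^sub>R scaleY c x" for t x
        by (simp add: mult.commute flip: Y.scale_of_real)
      show "norm (scaleY c x) \<le> norm x * norm c" for x
        by (simp add: Y.norm_scale mult.commute)
    qed (rule Y.scale_right_distrib)
    from has_sum_bounded_linear [OF this has_sum_M [of f]]
    show "((\<lambda>k. scaleY (m k * blinfun_apply (\<psi> k) (scaleX c f)) (\<phi> k)) has_sum scaleY c (M f)) I"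
      by (rule has_sum_cong [THEN iffD1, rotated])
        (use \<psi>_dual in \<open>simp add: dual_def mult_ac\<close>)
  qed
  have "bounded_linear M"
  proof (rule bounded_linear_intro)
    show "M (f + g) = M f + M g" for f g
      by (rule has_sum_unique [OF has_sum_M])
        (use has_sum_add [OF has_sum_M [of f] has_sum_M [of g]] in
          \<open>simp add: blinfun.add_right distrib_left Y.scale_left_distrib\<close>)
    show "M (t *\<^sub>R f) = t *\<^sub>R M f" for t f
      using M_scale [of "of_real t" f] by (simp add: X.scale_of_real Y.scale_of_real)
    show "norm (M f) \<le> norm f * (B2 * K * B1)" for f
    proof -
      have "norm (M f) \<le> B2 * lp_norm (ennreal p) I (\<lambda>k. m k * blinfun_apply (\<psi> k) f)"
        unfolding M_def multiplier_def by (rule Y.synthesis_summable [OF pq \<phi> coeff(1)])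
      also have "\<dots> \<le> B2 * (K * (B1 * norm f))"
        using B by (intro mult_left_mono coeff(2)) simp
      finally show ?thesis
        by (simp add: mult_ac)
    qed
  qed

  have conj_q: "conjugate_exponent (ennreal q) = ennreal p"
    and conj_p: "conjugate_exponent (ennreal p) = ennreal q"
    using pq qp by (simp_all add: conjugate_exponent_ennreal)

  have "t *\<^sub>R f \<in> dual scaleX" if "f \<in> dual scaleX" for t f
    using dual_scale_in_dual [OF that, of "of_real t"] by (simp add: dual_scale_of_real)
  then have weak_\<psi>: "weakly_summable (ennreal p) (dual scaleX) dual_scale (pad I \<psi>)"
      "weak_norm (ennreal p) (dual scaleX) dual_scale (pad I \<psi>) \<le> ennreal B1"
    using pq B by (auto intro!: weak_summability_pad [where B = B1] I dual_zero \<psi>_dual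
        dual_scale_of_real functional_of_bessel_bounded [OF pq \<psi>])
  have weak_\<phi>: "weakly_summable (ennreal q) UNIV scaleY (pad I \<phi>)"
      "weak_norm (ennreal q) UNIV scaleY (pad I \<phi>) \<le> ennreal B2"
    using pq B by (auto intro!: weak_summability_pad [where B = B2] I
        Y.scale_of_real Y.functional_of_dual_bessel_bounded [OF \<phi>])

  have "(\<lambda>n. scaleY (pad I m n * blinfun_apply (pad I \<psi> n) f) (pad I \<phi> n)) sums M f" for f
  proof -
    have "(\<lambda>n. scaleY (pad I m n * blinfun_apply (pad I \<psi> n) f) (pad I \<phi> n))
        = pad I (\<lambda>k. scaleY (m k * blinfun_apply (\<psi> k) f) (\<phi> k))"
      by (auto simp: pad_def)
    then show ?thesis
      using has_sum_M by (simp add: has_sum_imp_sums has_sum_pad I)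
  qed
  then have repr: "nuclear_representation (ennreal r) (ennreal p) (ennreal q) scaleX scaleY M
      (pad I m) (pad I \<psi>) (pad I \<phi>)"
    using m weak_\<psi>(1) weak_\<phi>(1)
    by (simp add: nuclear_representation_def conj_p conj_q lp_pad I r)

  have "inverse (ennreal p) + inverse (ennreal q) = ennreal (inverse p + inverse q)"
    using pq by (simp add: inverse_ennreal)
  also have "\<dots> = 1"
    using pq by (simp add: inverse_eq_divide)
  finally have "nuclear (ennreal r) (ennreal p) (ennreal q) scaleX scaleY M"
    using repr \<open>bounded_linear M\<close> M_scale r pq
    unfolding nuclear_def by (auto simp: ennreal_1 [symmetric] simp del: ennreal_1)
  moreover have "nuclear_norm (ennreal r) (ennreal p) (ennreal q) scaleX scaleY M
      \<le> ennreal (B1 * B2 * lp_norm (ennreal r) I m)"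
  proof -
    have "nuclear_norm (ennreal r) (ennreal p) (ennreal q) scaleX scaleY M
        \<le> ennreal (lp_norm (ennreal r) UNIV (pad I m))
            * weak_norm (ennreal p) (dual scaleX) dual_scale (pad I \<psi>)
            * weak_norm (ennreal q) UNIV scaleY (pad I \<phi>)"
      unfolding nuclear_norm_def conj_p conj_q using repr by (intro Inf_lower) blast
    also have "\<dots> \<le> ennreal (lp_norm (ennreal r) I m) * ennreal B1 * ennreal B2"
      unfolding lp_pad(2) [OF I r] by (intro mult_mono weak_\<psi>(2) weak_\<phi>(2)) auto
    also have "\<dots> = ennreal (B1 * B2 * lp_norm (ennreal r) I m)"
      using B r by (simp add: lp_norm_nonneg mult_ac flip: ennreal_mult)
    finally show ?thesis .
  qed
  ultimately show ?thesis
    using summable unfolding M_def by blast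
qed

end
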